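(* If $\mathcal{I}$ is a simple density ideal, then $\mathcal{I}\leq_K\mathcal{Z}$.
   Context: $\omega=\{0,1,2,\ldots\}$ and $n\in\omega$ is identified with $\{0,\ldots,n-1\}$. $G$ is the set of all functions $g\colon\omega\to(0,\infty)$ such that $g(n)\to\infty$ and $\frac{n}{g(n)}\not\to 0$. A simple density ideal is an ideal of the form $\mathcal{Z}_g=\{A\subseteq\omega:\ \lim_{n\to\infty}\frac{\mathrm{card}(A\cap n)}{g(n)}=0\}$ for some $g\in G$. $\mathcal{Z}=\{A\subseteq\omega:\ \lim_{n\to\infty}\frac{\mathrm{card}(A\cap n)}{n}=0\}$ is the classical density ideal. Katětov order: for ideals $\mathcal{I},\mathcal{J}$ on $\omega$, $\mathcal{I}\leq_K\mathcal{J}$ if there is a function $\phi\colon\omega\to\omega$ (not necessarily a bijection) such that for all $A\subseteq\omega$, $A\in\mathcal{I}$ implies $\phi^{-1}[A]\in\mathcal{J}$. *)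

theory Defs
  imports Complex_Main
begin

definition is_ideal :: "nat set set \<Rightarrow> bool" where
  "is_ideal I \<longleftrightarrow>
     (\<forall>A B. A \<in> I \<longrightarrow> B \<subseteq> A \<longrightarrow> B \<in> I) \<and>
     (\<forall>A B. A \<in> I \<longrightarrow> B \<in> I \<longrightarrow> A \<union> B \<in> I) \<and>
     (\<forall>F. finite F \<longrightarrow> F \<in> I) \<and>
     UNIV \<notin> I"

definition G :: "(nat \<Rightarrow> real) set" where
  "G = {g. (\<forall>n. 0 < g n) \<and> filterlim g at_top sequentially \<and>
           \<not> ((\<lambda>n. real n / g n) \<longlonglongrightarrow> 0)}"

(* The number n is identified with {0,...,n-1}, written {..<n}. *)

definition Z_of :: "(nat \<Rightarrow> real) \<Rightarrow> nat set set" where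
  "Z_of g = {A. (\<lambda>n. real (card (A \<inter> {..<n})) / g n) \<longlonglongrightarrow> 0}"

definition simple_density_ideal :: "nat set set \<Rightarrow> bool" where
  "simple_density_ideal I \<longleftrightarrow> (\<exists>g\<in>G. I = Z_of g)"

definition density_zero :: "nat set set" where
  "density_zero = {A. (\<lambda>n. real (card (A \<inter> {..<n})) / real n) \<longlonglongrightarrow> 0}"

definition katetov_le :: "nat set set \<Rightarrow> nat set set \<Rightarrow> bool"  (infix "\<le>\<^sub>K" 50) where
  "I \<le>\<^sub>K J \<longleftrightarrow> (\<exists>\<phi>::nat \<Rightarrow> nat. \<forall>A. A \<in> I \<longrightarrow> \<phi> -` A \<in> J)"

(* Every Z_of g with g in G, and density_zero, is an ideal (proved below), so is_ideal
   is not required separately in simple_density_ideal or katetov_le. *)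

lemma is_ideal_aux:
  fixes g :: "nat \<Rightarrow> real"
  assumes nonneg: "\<And>n. 0 \<le> g n" and lim: "filterlim g at_top sequentially"
    and nz: "\<not> ((\<lambda>n. real n / g n) \<longlonglongrightarrow> 0)"
  shows "is_ideal (Z_of g)"
proof -
  have squeeze0: "(\<lambda>n. real (card (C \<inter> {..<n})) / g n) \<longlonglongrightarrow> 0"
    if "\<And>n. real (card (C \<inter> {..<n})) / g n \<le> h n" "h \<longlonglongrightarrow> 0" for C h
    by (rule tendsto_sandwich[where f = "\<lambda>_. 0" and h = h]) (use that nonneg in auto)
  show ?thesis
    unfolding is_ideal_def
  proof (intro conjI allI impI)
    fix A B assume A: "A \<in> Z_of g" and "B \<subseteq> A"
    have "real (card (B \<inter> {..<n})) / g n \<le> real (card (A \<inter> {..<n})) / g n" for n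
      using \<open>B \<subseteq> A\<close> nonneg by (intro divide_right_mono of_nat_mono card_mono) auto
    moreover have "(\<lambda>n. real (card (A \<inter> {..<n})) / g n) \<longlonglongrightarrow> 0"
      using A by (simp add: Z_of_def)
    ultimately show "B \<in> Z_of g"
      unfolding Z_of_def mem_Collect_eq by (rule squeeze0)
  next
    fix A B assume AB: "A \<in> Z_of g" "B \<in> Z_of g"
    have "real (card ((A \<union> B) \<inter> {..<n})) / g n
        \<le> real (card (A \<inter> {..<n})) / g n + real (card (B \<inter> {..<n})) / g n" for n
    proof -
      have "card ((A \<union> B) \<inter> {..<n}) \<le> card (A \<inter> {..<n}) + card (B \<inter> {..<n})"
        by (metis Int_Un_distrib2 card_Un_le)
      then show ?thesis
        unfolding add_divide_distrib[symmetric] using nonneg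
        by (intro divide_right_mono) linarith+
    qed
    moreover have "(\<lambda>n. real (card (A \<inter> {..<n})) / g n + real (card (B \<inter> {..<n})) / g n) \<longlonglongrightarrow> 0"
      using AB tendsto_add[of _ 0 sequentially _ 0] by (auto simp: Z_of_def)
    ultimately show "A \<union> B \<in> Z_of g"
      unfolding Z_of_def mem_Collect_eq by (rule squeeze0)
  next
    fix F :: "nat set" assume "finite F"
    have "real (card (F \<inter> {..<n})) / g n \<le> real (card F) / g n" for n
      using \<open>finite F\<close> nonneg by (intro divide_right_mono of_nat_mono card_mono) auto
    moreover have "(\<lambda>n. real (card F) / g n) \<longlonglongrightarrow> 0"
      by (rule real_tendsto_divide_at_top[OF tendsto_const lim])
    ultimately show "F \<in> Z_of g"
      unfolding Z_of_def mem_Collect_eq by (rule squeeze0)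
  next
    show "UNIV \<notin> Z_of g"
      using nz by (simp add: Z_of_def)
  qed
qed

lemma is_ideal_simple_density_ideal: "simple_density_ideal I \<Longrightarrow> is_ideal I"
  unfolding simple_density_ideal_def G_def using is_ideal_aux less_imp_le by blast

lemma is_ideal_density_zero: "is_ideal density_zero"
proof -
  have "\<not> ((\<lambda>n. real n / real n) \<longlonglongrightarrow> 0)"
  proof
    assume "(\<lambda>n. real n / real n) \<longlonglongrightarrow> 0"
    moreover have "(\<lambda>n. real n / real n) \<longlonglongrightarrow> 1"
      by (rule tendsto_eventually, rule eventually_sequentiallyI[of 1]) simp
    ultimately show False
      using LIMSEQ_unique by fastforce
  qed
  then have "is_ideal (Z_of real)"
    by (intro is_ideal_aux filterlim_real_sequentially) simp
  then show ?thesis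
    by (simp add: Z_of_def density_zero_def)
qed

end

theory Submission
  imports Defs "HOL-Library.Infinite_Set"
begin

text \<open>
  Since \<open>n / g n\<close> does not tend to 0, there is \<open>c > 0\<close> such that
  \<open>D = {n. c * g n \<le> n}\<close> is infinite, and every \<open>A \<in> Z_of g\<close> has density tending to 0 on the
  initial segments \<open>{..<n}\<close> with \<open>n \<in> D\<close>. Cut \<open>\<omega>\<close> into consecutive blocks whose lengths lie in
  \<open>D\<close> and tend to infinity so slowly that no block is much longer than its starting point, and let
  \<open>\<phi>\<close> map each block of length \<open>n\<close> increasingly onto \<open>{..<n}\<close>. Each complete block contributes
  a small proportion to the preimage of \<open>A\<close>, and so does the last, incomplete block, because the
  whole of it is comparable in length with what precedes it.
\<close>

text \<open>The left end of the block containing the argument. Block lengths are indexed by left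
  ends, so a block starting at \<open>s\<close> is \<open>{s..<s + L s}\<close>.\<close>

primrec block_start :: "(nat \<Rightarrow> nat) \<Rightarrow> nat \<Rightarrow> nat" where
  "block_start L 0 = 0"
| "block_start L (Suc m) =
     (if Suc m < block_start L m + L (block_start L m) then block_start L m else Suc m)"

lemma block_start_le: "block_start L m \<le> m"
  by (induction m) auto

lemma less_block_end:
  assumes "\<And>s. 0 < L s"
  shows "m < block_start L m + L (block_start L m)"
  by (cases m) (use assms in auto)

lemma card_Int_lessThan_Suc:
  "card (A \<inter> {..<Suc n}) = card (A \<inter> {..<n}) + (if n \<in> A then 1 else 0)"
  by (auto simp: lessThan_Suc)

lemma card_Int_lessThan_le: "card (A \<inter> {..<n::nat}) \<le> n"
  by (metis card_lessThan card_mono finite_lessThan inf_le2)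

text \<open>The last summand counts the current block exactly. When that block is complete,
  \<open>sparse\<close> converts this count into \<open>\<epsilon>\<close> times its length; blocks
  starting before \<open>M\<close> are absorbed by the constant.\<close>

lemma card_block_vimage_le:
  fixes A :: "nat set" and \<epsilon> :: real
  assumes pos: "\<And>s. 0 < L s" and le: "\<And>s. L s \<le> Suc s" and "0 \<le> \<epsilon>"
    and sparse: "\<And>s. M \<le> s \<Longrightarrow> real (card (A \<inter> {..<L s})) \<le> \<epsilon> * real (L s)"
  shows "real (card ((\<lambda>k. k - block_start L k) -` A \<inter> {..<m}))
    \<le> real (2 * M + 1) + \<epsilon> * real (block_start L m) + real (card (A \<inter> {..<m - block_start L m}))"
proof (induction m)
  case 0
  then show ?case by simp
next
  case (Suc m)
  let ?P = "(\<lambda>k. k - block_start L k) -` A" and ?s = "block_start L m"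
  have sm: "?s \<le> m" "m < ?s + L ?s"
    using block_start_le less_block_end pos by auto
  \<comment> \<open>The point \<open>m\<close> is mapped to \<open>m - ?s\<close>, so including it
    raises both sides by the same amount.\<close>
  have step: "real (card (?P \<inter> {..<Suc m}))
      \<le> real (2 * M + 1) + \<epsilon> * real ?s + real (card (A \<inter> {..<Suc m - ?s}))"
    using Suc.IH sm(1) by (simp add: Suc_diff_le card_Int_lessThan_Suc)
  show ?case
  proof (cases "Suc m < ?s + L ?s")
    case True
    then show ?thesis using step by simp
  next
    case new: False
    with sm have L: "Suc m = ?s + L ?s" by simp
    from new have "block_start L (Suc m) = Suc m" by simp
    then have start: "block_start L (Suc m) = ?s + L ?s" using L by (rule trans)
    show ?thesis
    proof (cases "M \<le> ?s")
      case True
      then have "real (card (A \<inter> {..<Suc m - ?s})) \<le> \<epsilon> * real (L ?s)"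
        using sparse L by simp
      then show ?thesis using step unfolding start by (simp add: distrib_left)
    next
      case False
      \<comment> \<open>A block starting before \<open>M\<close> has length at most
        \<open>M\<close>, so everything up to its end fits into the constant.\<close>
      then have "card (?P \<inter> {..<Suc m}) \<le> 2 * M + 1"
        using card_Int_lessThan_le[of ?P "Suc m"] le[of ?s] L by linarith
      then have "real (card (?P \<inter> {..<Suc m})) \<le> real (2 * M + 1)"
        by (rule of_nat_mono)
      moreover have "0 \<le> \<epsilon> * real (block_start L (Suc m))" using \<open>0 \<le> \<epsilon>\<close> by simp
      ultimately show ?thesis by linarith
    qed
  qed
qed

lemma block_vimage_density_zero:
  fixes A :: "nat set"
  assumes pos: "\<And>s. 0 < L s" and le: "\<And>s. L s \<le> Suc s"
    and lim: "(\<lambda>s. real (card (A \<inter> {..<L s})) / real (L s)) \<longlonglongrightarrow> 0"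
  shows "(\<lambda>k. k - block_start L k) -` A \<in> density_zero"
proof -
  let ?P = "(\<lambda>k. k - block_start L k) -` A"
  have "(\<lambda>m. real (card (?P \<inter> {..<m})) / real m) \<longlonglongrightarrow> 0"
  proof (rule LIMSEQ_I)
    fix r :: real assume "0 < r"
    \<comment> \<open>One multiple \<open>\<epsilon> * m\<close> pays for the complete blocks, one
      for the last block, and one will absorb the constant.\<close>
    define \<epsilon> where "\<epsilon> = r / 4"
    have "0 < \<epsilon>" using \<open>0 < r\<close> by (simp add: \<epsilon>_def)
    obtain M where "\<And>s. M \<le> s \<Longrightarrow> real (card (A \<inter> {..<L s})) / real (L s) < \<epsilon>"
      using LIMSEQ_D[OF lim \<open>0 < \<epsilon>\<close>] by fastforce
    then have sparse: "real (card (A \<inter> {..<L s})) \<le> \<epsilon> * real (L s)" if "M \<le> s" for s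
      using that pos[of s] by (simp add: less_imp_le flip: pos_divide_le_eq)
    have bound: "real (card (?P \<inter> {..<m})) \<le> real (2 * M + 1) + \<epsilon> + 2 * \<epsilon> * real m" for m
    proof -
      let ?s = "block_start L m"
      have sm: "?s \<le> m" "m < ?s + L ?s"
        using block_start_le less_block_end pos by auto
      show ?thesis
      proof (cases "M \<le> ?s")
        case True
        \<comment> \<open>An incomplete block is enlarged to the full length \<open>L ?s\<close>,
          where \<open>sparse\<close> applies; \<open>le\<close> keeps that length at most
          \<open>Suc m\<close>.\<close>
        have "real (card (A \<inter> {..<m - ?s})) \<le> real (card (A \<inter> {..<L ?s}))"
          using sm by (intro of_nat_mono card_mono) auto
        also have "\<dots> \<le> \<epsilon> * real (L ?s)" using sparse True .
        also have "\<dots> \<le> \<epsilon> * real (Suc m)"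
          using le[of ?s] sm \<open>0 < \<epsilon>\<close> by (intro mult_left_mono) auto
        finally have "real (card (A \<inter> {..<m - ?s})) \<le> \<epsilon> * real m + \<epsilon>"
          by (simp add: distrib_left)
        moreover have "\<epsilon> * real ?s \<le> \<epsilon> * real m"
          using sm \<open>0 < \<epsilon>\<close> by simp
        moreover have "real (card (?P \<inter> {..<m}))
            \<le> real (2 * M + 1) + \<epsilon> * real ?s + real (card (A \<inter> {..<m - ?s}))"
          using pos le _ sparse by (rule card_block_vimage_le) (use \<open>0 < \<epsilon>\<close> in auto)
        ultimately show ?thesis by linarith
      next
        case False
        then have "card (?P \<inter> {..<m}) \<le> 2 * M + 1"
          using card_Int_lessThan_le[of ?P m] le[of ?s] sm by linarith
        then have "real (card (?P \<inter> {..<m})) \<le> real (2 * M + 1)"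
          by (rule of_nat_mono)
        moreover have "0 \<le> \<epsilon> * real m" using \<open>0 < \<epsilon>\<close> by simp
        ultimately show ?thesis using \<open>0 < \<epsilon>\<close> by linarith
      qed
    qed
    obtain N where N: "(real (2 * M + 1) + \<epsilon>) / \<epsilon> < real N"
      using reals_Archimedean2 by blast
    \<comment> \<open>\<open>Suc N\<close> guarantees \<open>m > 0\<close> for the division.\<close>
    have "norm (real (card (?P \<inter> {..<m})) / real m - 0) < r" if "Suc N \<le> m" for m
    proof -
      have "real (2 * M + 1) + \<epsilon> < \<epsilon> * real N"
        using N \<open>0 < \<epsilon>\<close> by (simp add: pos_divide_less_eq mult.commute)
      also have "\<dots> \<le> \<epsilon> * real m" using that \<open>0 < \<epsilon>\<close> by simp
      finally have "real (card (?P \<inter> {..<m})) < 3 * \<epsilon> * real m"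
        using bound[of m] by linarith
      also have "\<dots> \<le> r * real m"
        using \<open>0 < r\<close> by (intro mult_right_mono) (auto simp: \<epsilon>_def)
      finally show ?thesis using that by (simp add: pos_divide_less_eq)
    qed
    then show "\<exists>N. \<forall>m\<ge>N. norm (real (card (?P \<inter> {..<m})) / real m - 0) < r" by blast
  qed
  then show ?thesis by (simp add: density_zero_def)
qed

lemma slow_enumeration:
  fixes D :: "nat set"
  assumes "infinite D"
  obtains L where "\<And>s. 0 < L s" "\<And>s. L s \<le> Suc s" "filterlim L at_top sequentially"
    "eventually (\<lambda>s. L s \<in> D) sequentially"
proof
  \<comment> \<open>The largest element of \<open>D\<close> up to \<open>s\<close>; the default 1
    makes the set nonempty and \<open>L\<close> positive, and forces the bound \<open>Suc s\<close>
    at \<open>s = 0\<close>.\<close>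
  define L where "L s = Max (insert 1 (D \<inter> {..s}))" for s
  have mem: "L s \<in> insert 1 (D \<inter> {..s})" for s
    unfolding L_def by (rule Max_in) auto
  have ge: "d \<le> L s" if "d \<in> insert 1 (D \<inter> {..s})" for d s
    unfolding L_def using that by (intro Max_ge) auto
  show "0 < L s" for s using ge[of 1 s] by simp
  show "L s \<le> Suc s" for s using mem[of s] by auto
  show lim: "filterlim L at_top sequentially"
    unfolding filterlim_at_top
  proof
    fix Z
    obtain d where d: "d \<in> D" "Z \<le> d"
      using assms by (meson infinite_nat_iff_unbounded_le)
    then show "eventually (\<lambda>s. Z \<le> L s) sequentially"
      by (intro eventually_sequentiallyI[of d]) (use ge in force)
  qed
  \<comment> \<open>A value of at least 2 cannot be the default, so it comes from
    \<open>D\<close>.\<close>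
  have "eventually (\<lambda>s. 2 \<le> L s) sequentially"
    using lim by (simp add: filterlim_at_top)
  then show "eventually (\<lambda>s. L s \<in> D) sequentially"
    by eventually_elim (use mem in force)
qed

theorem theorem4:
  fixes I :: "nat set set"
  assumes "simple_density_ideal I"
  shows "I \<le>\<^sub>K density_zero"
proof -
  obtain g where gpos: "\<And>n. 0 < g n" and nz: "\<not> ((\<lambda>n. real n / g n) \<longlonglongrightarrow> 0)"
    and I: "I = Z_of g"
    using assms by (auto simp: simple_density_ideal_def G_def)
  obtain c where "0 < c" and c: "\<And>N. \<exists>n\<ge>N. c \<le> real n / g n"
    using nz gpos by (auto simp: LIMSEQ_iff not_less less_imp_le)
  define D where "D = {n. c * g n \<le> real n}"
  have "infinite D"
    unfolding infinite_nat_iff_unbounded_le D_def using c gpos by (auto simp: pos_le_divide_eq)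
  then obtain L where pos: "\<And>s. 0 < L s" and le: "\<And>s. L s \<le> Suc s"
    and lim: "filterlim L at_top sequentially" and inD: "eventually (\<lambda>s. L s \<in> D) sequentially"
    by (rule slow_enumeration) blast
  have "(\<lambda>k. k - block_start L k) -` A \<in> density_zero" if "A \<in> I" for A
  proof (rule block_vimage_density_zero[OF pos le])
    have "(\<lambda>n. real (card (A \<inter> {..<n})) / g n) \<longlonglongrightarrow> 0"
      using that by (simp add: I Z_of_def)
    then have "(\<lambda>s. real (card (A \<inter> {..<L s})) / g (L s)) \<longlonglongrightarrow> 0"
      using lim by (rule filterlim_compose)
    then have upper: "(\<lambda>s. real (card (A \<inter> {..<L s})) / g (L s) / c) \<longlonglongrightarrow> 0"
      by (rule tendsto_divide_zero)
    \<comment> \<open>For \<open>L s\<close> in \<open>D\<close>, replacing the denominator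
      \<open>g (L s)\<close> by \<open>L s\<close> costs at most a factor
      \<open>1 / c\<close>.\<close>
    have "eventually (\<lambda>s. real (card (A \<inter> {..<L s})) / real (L s)
        \<le> real (card (A \<inter> {..<L s})) / g (L s) / c) sequentially"
      using inD
    proof eventually_elim
      case (elim s)
      then have "real (card (A \<inter> {..<L s})) / real (L s)
          \<le> real (card (A \<inter> {..<L s})) / (c * g (L s))"
        using \<open>0 < c\<close> gpos by (intro divide_left_mono) (auto simp: D_def pos)
      then show ?case by (simp add: mult.commute)
    qed
    then show "(\<lambda>s. real (card (A \<inter> {..<L s})) / real (L s)) \<longlonglongrightarrow> 0"
      by (intro tendsto_sandwich[OF _ _ tendsto_const upper]) auto
  qed
  then show ?thesis unfolding katetov_le_def by blast
qed

end
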